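(* Let $X$ be a convex subset of a Euclidean space and let $\succcurlyeq$ be a binary relation on $X$. Then $\succcurlyeq$ is linearly continuous if and only if it is both mixture-continuous and Archimedean.
   Context: No property (completeness, transitivity, reflexivity) of the binary relation $\succcurlyeq\subseteq X\times X$ is assumed. Its asymmetric part is: $x\succ y$ iff $x\succcurlyeq y$ and not $y\succcurlyeq x$. Write $x\preccurlyeq y$ for $y\succcurlyeq x$ and $x\prec y$ for $y\succ x$. For $x\in X$ and $R\in\{\succcurlyeq,\preccurlyeq,\succ,\prec\}$ let $A_R(x)=\{y\in X: y\,R\,x\}$. For $S\subseteq X$, the restriction of $\succcurlyeq$ to $S$ is continuous if for all $x\in X$ (not just $x\in S$), $A_\succcurlyeq(x)\cap S$ and $A_\preccurlyeq(x)\cap S$ are closed in $S$, and $A_\succ(x)\cap S$ and $A_\prec(x)\cap S$ are open in $S$. A straight line in $X$ is the intersection with $X$ of a one-dimensional affine subspace contained in the affine hull of $X$. $\succcurlyeq$ is linearly continuous if its restriction to every straight line in $X$ is continuous. For $x,y\in X$ and $\lambda\in[0,1]$, $x\lambda y$ denotes $\lambda x+(1-\lambda)y$. $\succcurlyeq$ is mixture-continuous if for all $x,y,z\in X$ the sets $\{\lambda\in[0,1]: x\lambda y\succcurlyeq z\}$ and $\{\lambda\in[0,1]: x\lambda y\preccurlyeq z\}$ are closed. $\succcurlyeq$ is Archimedean if for all $x,y,z\in X$ with $x\succ y$ there exist $\lambda,\delta\in(0,1)$ such that $x\lambda z\succ y$ and $x\succ y\delta z$. *)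

theory Defs
  imports "HOL-Analysis.Analysis"
begin

text \<open>
  A binary relation on \<open>X\<close> is a set of pairs \<open>R \<subseteq> X \<times> X\<close>, with \<open>(x, y) \<in> R\<close> for
  \<open>x \<succcurlyeq> y\<close>; then \<open>\<preccurlyeq>\<close>, \<open>\<succ>\<close> and \<open>\<prec>\<close> are \<open>R\<inverse>\<close>, \<open>asym_part R\<close> and
  \<open>(asym_part R)\<inverse>\<close>.
\<close>

definition asym_part :: "('a \<times> 'a) set \<Rightarrow> ('a \<times> 'a) set" where
  "asym_part R = {(x, y). (x, y) \<in> R \<and> (y, x) \<notin> R}"

definition sect :: "'a set \<Rightarrow> ('a \<times> 'a) set \<Rightarrow> 'a \<Rightarrow> 'a set" where
  "sect X R x = {y \<in> X. (y, x) \<in> R}"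

text \<open>The point \<open>x\<close> below ranges over all of \<open>X\<close>, not only over \<open>S\<close>.\<close>

definition continuous_restriction ::
  "'a::topological_space set \<Rightarrow> ('a \<times> 'a) set \<Rightarrow> 'a set \<Rightarrow> bool" where
  "continuous_restriction X R S \<longleftrightarrow>
    (\<forall>x\<in>X.
      closedin (top_of_set S) (sect X R x \<inter> S) \<and>
      closedin (top_of_set S) (sect X (R\<inverse>) x \<inter> S) \<and>
      openin (top_of_set S) (sect X (asym_part R) x \<inter> S) \<and>
      openin (top_of_set S) (sect X ((asym_part R)\<inverse>) x \<inter> S))"

definition straight_line_in :: "'a::euclidean_space set \<Rightarrow> 'a set \<Rightarrow> bool" where
  "straight_line_in X S \<longleftrightarrow>
    (\<exists>L. affine L \<and> aff_dim L = 1 \<and> L \<subseteq> affine hull X \<and> S = L \<inter> X)"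

definition linearly_continuous :: "'a::euclidean_space set \<Rightarrow> ('a \<times> 'a) set \<Rightarrow> bool" where
  "linearly_continuous X R \<longleftrightarrow>
    (\<forall>S. straight_line_in X S \<longrightarrow> continuous_restriction X R S)"

definition mix :: "'a::real_vector \<Rightarrow> real \<Rightarrow> 'a \<Rightarrow> 'a" where
  "mix x l y = l *\<^sub>R x + (1 - l) *\<^sub>R y"

definition mixture_continuous :: "'a::real_vector set \<Rightarrow> ('a \<times> 'a) set \<Rightarrow> bool" where
  "mixture_continuous X R \<longleftrightarrow>
    (\<forall>x\<in>X. \<forall>y\<in>X. \<forall>z\<in>X.
      closed {l \<in> {0..1}. (mix x l y, z) \<in> R} \<and>
      closed {l \<in> {0..1}. (mix x l y, z) \<in> R\<inverse>})"

definition Archimedean :: "'a::real_vector set \<Rightarrow> ('a \<times> 'a) set \<Rightarrow> bool" where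
  "Archimedean X R \<longleftrightarrow>
    (\<forall>x\<in>X. \<forall>y\<in>X. \<forall>z\<in>X. (x, y) \<in> asym_part R \<longrightarrow>
      (\<exists>l\<in>{0<..<1}. \<exists>d\<in>{0<..<1}.
        (mix x l z, y) \<in> asym_part R \<and> (x, mix y d z) \<in> asym_part R))"

end

theory Submission imports Defs begin

text \<open>
  Linear continuity passes to mixtures by pulling back along segments.
  Conversely, a subset of a line is open as soon as it is open along every segment issuing from
  each of its points, so everything reduces to segments. For the weak sections this is mixture
  continuity. Now let \<open>s \<succ> x\<close> and move from \<open>s\<close> towards \<open>y\<close>. By mixture continuity,
  \<open>x \<succcurlyeq> p\<close> fails for \<open>p\<close> near \<open>s\<close>. If \<open>p \<succcurlyeq> x\<close> failed at
  some such \<open>c\<close>, then, the upper section being closed, there would be a last point before \<open>c\<close> at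
  which it holds; there \<open>p \<succ> x\<close>, and the Archimedean property applied to that point and \<open>c\<close> gives
  a later one.
\<close>

section \<open>Mixtures, converse relations and lines through two points\<close>

lemma mix_mem: "convex X \<Longrightarrow> x \<in> X \<Longrightarrow> y \<in> X \<Longrightarrow> 0 \<le> l \<Longrightarrow> l \<le> 1 \<Longrightarrow> mix x l y \<in> X"
  unfolding mix_def by (rule convexD) auto

text \<open>Mixing two points of one segment mixes their parameters with the same weight. This turns
  the Archimedean property between two points of a segment into a statement about real
  parameters.\<close>

lemma mix_mix: "mix (mix y a s) l (mix y c s) = mix y (l * a + (1 - l) * c) s"
  unfolding mix_def by (simp add: algebra_simps)

lemma mix_0 [simp]: "mix x 0 y = y" and mix_1 [simp]: "mix x 1 y = x"
  by (simp_all add: mix_def)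

lemma mix_same [simp]: "mix x l x = x"
  by (simp add: mix_def algebra_simps)

lemma continuous_on_mix: "continuous_on A (\<lambda>l. mix x l (y :: 'a::real_normed_vector))"
  unfolding mix_def by (intro continuous_intros)

lemma asym_part_converse: "asym_part (R\<inverse>) = (asym_part R)\<inverse>"
  by (auto simp: asym_part_def)

lemma mixture_continuous_converse: "mixture_continuous X (R\<inverse>) \<longleftrightarrow> mixture_continuous X R"
  unfolding mixture_continuous_def by auto

text \<open>Reversing the relation exchanges the better and the worse point, so the two weights
  \<open>l\<close> and \<open>d\<close> simply trade places.\<close>

lemma Archimedean_converse:
  assumes "Archimedean X R"
  shows "Archimedean X (R\<inverse>)"
  using assms unfolding Archimedean_def asym_part_converse converse_iff by meson

lemma straight_line_through:
  assumes "x \<in> X" "y \<in> X" "x \<noteq> y"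
  shows "straight_line_in X (affine hull {x, y} \<inter> X)"
  unfolding straight_line_in_def
proof (intro exI conjI)
  show "aff_dim (affine hull {x, y}) = 1"
    using assms by (simp add: aff_dim_2)
  show "affine hull {x, y} \<subseteq> affine hull X"
    using assms by (intro hull_mono) auto
qed auto

lemma mix_in_line:
  assumes "convex X" "x \<in> X" "y \<in> X" "0 \<le> l" "l \<le> 1"
  shows "mix x l y \<in> affine hull {x, y} \<inter> X"
proof -
  have "mix x l y \<in> affine hull {x, y}"
    unfolding affine_hull_2 mix_def by force
  with mix_mem[OF assms] show ?thesis by blast
qed

lemma linearly_continuous_line:
  assumes "linearly_continuous X R" "x \<in> X" "y \<in> X" "x \<noteq> y"
  shows "continuous_restriction X R (affine hull {x, y} \<inter> X)"
  using assms straight_line_through unfolding linearly_continuous_def by blast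

section \<open>From linear continuity to mixtures\<close>

lemma closed_mix_preimage:
  fixes x y :: "'a::real_normed_vector"
  assumes "closedin (top_of_set S) W" and "\<And>l. l \<in> {0..1} \<Longrightarrow> mix x l y \<in> S"
  shows "closed {l \<in> {0..1}. mix x l y \<in> W}"
proof -
  have "closedin (top_of_set {0..1}) ({0..1} \<inter> (\<lambda>l. mix x l y) -` W)"
    using assms by (intro continuous_closedin_preimage_gen[where T = S] continuous_on_mix) auto
  then have "closed ({0..1} \<inter> (\<lambda>l. mix x l y) -` W)"
    using closedin_closed_trans by blast
  moreover have "{0..1} \<inter> (\<lambda>l. mix x l y) -` W = {l \<in> {0..1}. mix x l y \<in> W}" by auto
  ultimately show ?thesis by simp
qed

lemma linearly_continuous_imp_mixture_continuous:
  fixes X :: "'a::euclidean_space set"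
  assumes X: "convex X" and lc: "linearly_continuous X R"
  shows "mixture_continuous X R"
  unfolding mixture_continuous_def
proof (intro ballI)
  fix x y z assume xyz: "x \<in> X" "y \<in> X" "z \<in> X"
  show "closed {l \<in> {0..1}. (mix x l y, z) \<in> R} \<and> closed {l \<in> {0..1}. (mix x l y, z) \<in> R\<inverse>}"
  proof (cases "x = y")
    case True
    \<comment> \<open>Equal points span no line, but their mixture is constant, so the parameter set
      is empty or the whole unit interval.\<close>
    have "closed {l \<in> {0..1::real}. P}" for P
      by (cases P) (simp_all del: atLeastAtMost_iff)
    then show ?thesis using True by simp
  next
    case False
    let ?S = "affine hull {x, y} \<inter> X"
    have cr: "continuous_restriction X R ?S"
      using linearly_continuous_line[OF lc] xyz False by blast
    have mixS: "mix x l y \<in> ?S" if "l \<in> {0..1}" for l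
      using mix_in_line[OF X xyz(1,2)] that by auto
    have "{l \<in> {0..1}. mix x l y \<in> sect X Q z \<inter> ?S} = {l \<in> {0..1}. (mix x l y, z) \<in> Q}" for Q
      using mixS by (auto simp: sect_def)
    moreover have "closed {l \<in> {0..1}. mix x l y \<in> sect X R z \<inter> ?S}"
      "closed {l \<in> {0..1}. mix x l y \<in> sect X (R\<inverse>) z \<inter> ?S}"
      using cr xyz mixS unfolding continuous_restriction_def
      by (intro closed_mix_preimage[where S = ?S]; blast)+
    ultimately show ?thesis by simp
  qed
qed

text \<open>As the weight tends to 1 from below, the mixture tends to \<open>x\<close> and so enters
  the neighbourhood \<open>W\<close> at a weight strictly inside the unit interval.\<close>

lemma openin_mix:
  fixes x z :: "'a::real_normed_vector"
  assumes "openin (top_of_set S) W" "x \<in> W" and S: "\<And>l. l \<in> {0..1} \<Longrightarrow> mix x l z \<in> S"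
  shows "\<exists>l\<in>{0<..<1}. mix x l z \<in> W"
proof -
  obtain e where e: "e > 0" "\<And>p. p \<in> S \<Longrightarrow> dist p x < e \<Longrightarrow> p \<in> W"
    using assms(1,2) unfolding openin_euclidean_subtopology_iff by blast
  have "((\<lambda>l. mix x l z) \<longlongrightarrow> mix x 1 z) (at_left 1)"
    unfolding mix_def by (intro tendsto_intros)
  then have "\<forall>\<^sub>F l in at_left 1. dist (mix x l z) x < e"
    using e(1) by (simp add: tendsto_iff)
  moreover have "\<forall>\<^sub>F l in at_left (1::real). l \<in> {0<..<1}"
    by (rule eventually_at_leftI[of 0]) auto
  ultimately have "\<forall>\<^sub>F l in at_left 1. dist (mix x l z) x < e \<and> l \<in> {0<..<1}"
    by (rule eventually_conj)
  then obtain l where "dist (mix x l z) x < e" "l \<in> {0<..<1}"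
    using eventually_happens trivial_limit_at_left_real by blast
  moreover from this have "mix x l z \<in> W" using e(2) S by simp
  ultimately show ?thesis by blast
qed

lemma linearly_continuous_imp_Archimedean:
  fixes X :: "'a::euclidean_space set"
  assumes X: "convex X" and lc: "linearly_continuous X R"
  shows "Archimedean X R"
proof -
  \<comment> \<open>Both Archimedean weights come from this one claim: \<open>asym_part R\<close>
    serves for moving the better point, its converse for moving the worse one.\<close>
  have *: "\<exists>l\<in>{0<..<1}. (mix x l z, y) \<in> Q"
    if xyz: "x \<in> X" "y \<in> X" "z \<in> X" "(x, y) \<in> Q" and Q: "Q = asym_part R \<or> Q = (asym_part R)\<inverse>"
    for x y z Q
  proof (cases "x = z")
    case True
    have "(1/2::real) \<in> {0<..<1}" by simp
    then show ?thesis using True that(4) by (metis mix_same)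
  next
    case False
    let ?S = "affine hull {x, z} \<inter> X"
    have "continuous_restriction X R ?S"
      using linearly_continuous_line[OF lc] xyz False by blast
    then have "openin (top_of_set ?S) (sect X Q y \<inter> ?S)"
      using Q xyz unfolding continuous_restriction_def by blast
    moreover have "x \<in> sect X Q y \<inter> ?S"
      using xyz by (auto simp: sect_def hull_inc)
    moreover have "mix x l z \<in> ?S" if "l \<in> {0..1}" for l
      using mix_in_line[OF X xyz(1,3)] that by auto
    ultimately have "\<exists>l\<in>{0<..<1}. mix x l z \<in> sect X Q y \<inter> ?S"
      by (rule openin_mix)
    then show ?thesis by (auto simp: sect_def)
  qed
  show ?thesis
    unfolding Archimedean_def
  proof (intro ballI impI)
    fix x y z assume xyz: "x \<in> X" "y \<in> X" "z \<in> X" and "(x, y) \<in> asym_part R"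
    then show "\<exists>l\<in>{0<..<1}. \<exists>d\<in>{0<..<1}.
        (mix x l z, y) \<in> asym_part R \<and> (x, mix y d z) \<in> asym_part R"
      using *[of x y z "asym_part R"] *[of y x z "(asym_part R)\<inverse>"] by auto
  qed
qed

section \<open>From segments to the topology of a line\<close>

text \<open>On a line only two directions leave \<open>s\<close>, so the smaller of two positive
  radii gives a neighbourhood. In higher dimensions, openness along segments would not yield
  openness.\<close>

lemma collinear_openin:
  fixes S :: "'a::euclidean_space set"
  assumes S: "collinear S"
    and rad: "\<And>s y. s \<in> S \<Longrightarrow> s \<in> U \<Longrightarrow> y \<in> S \<Longrightarrow> \<exists>e>0. \<forall>l. 0 \<le> l \<and> l < e \<and> l \<le> 1 \<longrightarrow> mix y l s \<in> U"
  shows "openin (top_of_set S) (U \<inter> S)"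
  unfolding openin_euclidean_subtopology_iff
proof (intro conjI ballI)
  show "U \<inter> S \<subseteq> S" by blast
  fix s assume s: "s \<in> U \<inter> S"
  \<comment> \<open>\<open>u\<close> is a common direction of \<open>S\<close>. It may be zero, in
    which case \<open>S\<close> is just the point \<open>s\<close>.\<close>
  obtain u where u: "\<And>p q. p \<in> S \<Longrightarrow> q \<in> S \<Longrightarrow> \<exists>c. p - q = c *\<^sub>R u"
    using S unfolding collinear_def by blast
  have ray: "\<exists>e>0. \<forall>r. 0 \<le> r \<and> r < e \<and> s + r *\<^sub>R v \<in> S \<longrightarrow> s + r *\<^sub>R v \<in> U" for v
  proof (cases "\<exists>t>0. s + t *\<^sub>R v \<in> S")
    case True
    then obtain t where t: "t > 0" "s + t *\<^sub>R v \<in> S" by blast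
    obtain e where e: "e > 0" "\<And>l. 0 \<le> l \<Longrightarrow> l < e \<Longrightarrow> l \<le> 1 \<Longrightarrow> mix (s + t *\<^sub>R v) l s \<in> U"
      using rad[of s "s + t *\<^sub>R v"] s t by blast
    \<comment> \<open>The mixing weight is \<open>r / t\<close>: the bound \<open>t * e\<close>
      keeps it below \<open>e\<close>, and the bound \<open>t\<close> keeps it at most 1.\<close>
    have "s + r *\<^sub>R v \<in> U" if "0 \<le> r" "r < min (t * e) t" for r
    proof -
      have "mix (s + t *\<^sub>R v) (r / t) s \<in> U"
        using e(2)[of "r / t"] that t by (simp add: field_simps)
      moreover have "mix (s + t *\<^sub>R v) (r / t) s = s + r *\<^sub>R v"
        using t by (simp add: mix_def algebra_simps)
      ultimately show ?thesis by simp
    qed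
    moreover have "min (t * e) t > 0" using t e by simp
    ultimately show ?thesis by blast
  next
    case False
    then have "s + r *\<^sub>R v \<in> U" if "0 \<le> r" "s + r *\<^sub>R v \<in> S" for r
      using that s by (cases "r = 0") auto
    then show ?thesis using zero_less_one by blast
  qed
  obtain e1 where e1: "e1 > 0" "\<And>r. 0 \<le> r \<Longrightarrow> r < e1 \<Longrightarrow> s + r *\<^sub>R u \<in> S \<Longrightarrow> s + r *\<^sub>R u \<in> U"
    using ray[of u] by blast
  obtain e2 where e2: "e2 > 0" "\<And>r. 0 \<le> r \<Longrightarrow> r < e2 \<Longrightarrow> s + r *\<^sub>R (- u) \<in> S \<Longrightarrow> s + r *\<^sub>R (- u) \<in> U"
    using ray[of "- u"] by blast
  show "\<exists>e>0. \<forall>p\<in>S. dist p s < e \<longrightarrow> p \<in> U \<inter> S"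
  proof (cases "u = 0")
    case True
    then have "p = s" if "p \<in> S" for p using u[of p s] s that by auto
    then show ?thesis using s by (intro exI[of _ 1]) auto
  next
    case False
    \<comment> \<open>The distance from \<open>s\<close> to \<open>s + c *\<^sub>R u\<close> is
      \<open>\<bar>c\<bar> * norm u\<close>, and the sign of \<open>c\<close> selects the
      ray.\<close>
    have "p \<in> U" if p: "p \<in> S" "dist p s < min e1 e2 * norm u" for p
    proof -
      obtain c where c: "p - s = c *\<^sub>R u" using u p s by blast
      then have ps: "p = s + c *\<^sub>R u" by (simp add: algebra_simps)
      then have "\<bar>c\<bar> < min e1 e2" using p False by (simp add: dist_norm)
      then show ?thesis
        using e1(2)[of c] e2(2)[of "- c"] p(1) ps by (cases "c \<ge> 0") auto
    qed
    then show ?thesis using False e1 e2 by (intro exI[of _ "min e1 e2 * norm u"]) auto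
  qed
qed

lemma closed_avoid_right:
  fixes Q :: "real set"
  assumes "closed Q" "0 \<notin> Q"
  obtains e where "e > 0" "\<And>l. 0 \<le> l \<Longrightarrow> l < e \<Longrightarrow> l \<notin> Q"
proof -
  have "open (- Q)" "0 \<in> - Q" using assms by auto
  then obtain e where "e > 0" "ball 0 e \<subseteq> - Q" by (meson open_contains_ball)
  then show thesis by (intro that[of e]) (auto simp: subset_iff)
qed

lemma asym_part_segment:
  assumes X: "convex X" and mc: "mixture_continuous X R" and Ar: "Archimedean X R"
    and X3: "s \<in> X" "y \<in> X" "x \<in> X" and sx: "(s, x) \<in> asym_part R"
  shows "\<exists>e>0. \<forall>l. 0 \<le> l \<and> l < e \<and> l \<le> 1 \<longrightarrow> (mix y l s, x) \<in> asym_part R"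
proof -
  have clP: "closed {l \<in> {0..1}. (mix y l s, x) \<in> R}"
    and clQ: "closed {l \<in> {0..1}. (x, mix y l s) \<in> R}"
    using mc X3 unfolding mixture_continuous_def by auto
  have "0 \<notin> {l \<in> {0..1}. (x, mix y l s) \<in> R}"
    using sx by (simp add: asym_part_def)
  with clQ obtain e where e: "e > 0"
    and eQ: "\<And>l. 0 \<le> l \<Longrightarrow> l < e \<Longrightarrow> l \<notin> {l \<in> {0..1}. (x, mix y l s) \<in> R}"
    by (rule closed_avoid_right) blast
  have "(mix y c s, x) \<in> asym_part R" if c: "0 \<le> c" "c < e" "c \<le> 1" for c
  proof -
    \<comment> \<open>\<open>T\<close> collects the parameters up to \<open>c\<close> at which the
      weak relation holds. Compactness gives it a largest element \<open>a\<close>, and since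
      \<open>a \<le> c < e\<close> the relation there is strict.\<close>
    define T where "T = {l \<in> {0..1}. (mix y l s, x) \<in> R} \<inter> {0..c}"
    have "compact T" unfolding T_def using clP by (simp add: closed_Int_compact)
    moreover have "0 \<in> T" using sx c by (simp add: T_def asym_part_def)
    ultimately obtain a where a: "a \<in> T" "\<And>t. t \<in> T \<Longrightarrow> t \<le> a"
      using compact_attains_sup[of T] by blast
    have ac: "0 \<le> a" "a \<le> c" "(mix y a s, x) \<in> asym_part R"
      using a(1) c eQ[of a] by (auto simp: T_def asym_part_def)
    have "a = c"
    proof (rule ccontr)
      assume "a \<noteq> c"
      have "mix y a s \<in> X" "mix y c s \<in> X" using ac c by (auto intro!: mix_mem X X3)
      then obtain l where l: "l \<in> {0<..<1}" "(mix (mix y a s) l (mix y c s), x) \<in> asym_part R"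
        using Ar ac(3) X3(3) unfolding Archimedean_def by meson
      \<comment> \<open>\<open>b\<close> is the parameter of the mixture just obtained:
        \<open>l < 1\<close> puts it beyond \<open>a\<close>, and \<open>l > 0\<close> keeps it from
        passing \<open>c\<close>. It therefore lies in \<open>T\<close> and contradicts the
        maximality of \<open>a\<close>.\<close>
      define b where "b = l * a + (1 - l) * c"
      have "b - a = (1 - l) * (c - a)" "c - b = l * (c - a)"
        by (simp_all add: b_def algebra_simps)
      then have "0 < b - a" "0 \<le> c - b"
        using l(1) ac(2) \<open>a \<noteq> c\<close> by simp_all
      then have b: "a < b" "b \<le> c" by simp_all
      have "(mix y b s, x) \<in> asym_part R" using l(2) by (simp add: mix_mix b_def)
      then have "b \<in> T" using b ac c by (auto simp: T_def asym_part_def)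
      with a(2) b show False by fastforce
    qed
    with ac show ?thesis by simp
  qed
  with e show ?thesis by blast
qed

lemma openin_sect_asym_part:
  fixes X :: "'a::euclidean_space set"
  assumes X: "convex X" and mc: "mixture_continuous X R" and Ar: "Archimedean X R"
    and S: "collinear S" "S \<subseteq> X" and x: "x \<in> X"
  shows "openin (top_of_set S) (sect X (asym_part R) x \<inter> S)"
proof (rule collinear_openin[OF S(1)])
  fix s y assume s: "s \<in> S" "s \<in> sect X (asym_part R) x" and y: "y \<in> S"
  then obtain e where "e > 0" "\<forall>l. 0 \<le> l \<and> l < e \<and> l \<le> 1 \<longrightarrow> (mix y l s, x) \<in> asym_part R"
    using asym_part_segment[OF X mc Ar, of s y x] S(2) x by (auto simp: sect_def)
  then show "\<exists>e>0. \<forall>l. 0 \<le> l \<and> l < e \<and> l \<le> 1 \<longrightarrow> mix y l s \<in> sect X (asym_part R) x"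
    using mix_mem[OF X, of y s] s y S(2) by (auto simp: sect_def)
qed

text \<open>The complement is open along segments: a closed parameter set that misses 0 misses an
  initial interval.\<close>

lemma closedin_sect:
  fixes X :: "'a::euclidean_space set"
  assumes X: "convex X" and mc: "mixture_continuous X R"
    and S: "collinear S" "S \<subseteq> X" and x: "x \<in> X"
  shows "closedin (top_of_set S) (sect X R x \<inter> S)"
proof -
  have "openin (top_of_set S) ((- sect X R x) \<inter> S)"
  proof (rule collinear_openin[OF S(1)])
    fix s y assume s: "s \<in> S" "s \<in> - sect X R x" and y: "y \<in> S"
    have "closed {l \<in> {0..1}. (mix y l s, x) \<in> R}"
      using mc s y x S(2) unfolding mixture_continuous_def by blast
    moreover have "0 \<notin> {l \<in> {0..1}. (mix y l s, x) \<in> R}"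
      using s S(2) by (auto simp: sect_def)
    ultimately obtain e where "e > 0"
      "\<And>l. 0 \<le> l \<Longrightarrow> l < e \<Longrightarrow> l \<notin> {l \<in> {0..1}. (mix y l s, x) \<in> R}"
      by (rule closed_avoid_right) blast
    then show "\<exists>e>0. \<forall>l. 0 \<le> l \<and> l < e \<and> l \<le> 1 \<longrightarrow> mix y l s \<in> - sect X R x"
      by (intro exI[of _ e]) (auto simp: sect_def)
  qed
  moreover have "S - sect X R x \<inter> S = (- sect X R x) \<inter> S" by blast
  ultimately show ?thesis by (simp add: closedin_def)
qed

theorem theorem2:
  fixes X :: "'a::euclidean_space set"
    and R :: "('a \<times> 'a) set"
  assumes "convex X"
    and "R \<subseteq> X \<times> X"
  shows "linearly_continuous X R \<longleftrightarrow> mixture_continuous X R \<and> Archimedean X R"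
proof
  assume "linearly_continuous X R"
  then show "mixture_continuous X R \<and> Archimedean X R"
    using assms(1) linearly_continuous_imp_mixture_continuous linearly_continuous_imp_Archimedean
    by blast
next
  assume "mixture_continuous X R \<and> Archimedean X R"
  then have mc: "mixture_continuous X R" "mixture_continuous X (R\<inverse>)"
    and Ar: "Archimedean X R" "Archimedean X (R\<inverse>)"
    by (auto simp: mixture_continuous_converse Archimedean_converse)
  show "linearly_continuous X R"
    unfolding linearly_continuous_def
  proof (intro allI impI)
    fix S assume "straight_line_in X S"
    then obtain L where "aff_dim L = 1" and L: "S = L \<inter> X"
      unfolding straight_line_in_def by blast
    then have "collinear L" by (simp add: collinear_aff_dim)
    then have S: "collinear S" "S \<subseteq> X"
      using L by (auto intro: collinear_subset)
    show "continuous_restriction X R S"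
      \<comment> \<open>Lower sections of \<open>R\<close> are upper sections of its converse, which
        inherits both properties, so the two lemmas on upper sections settle all four
        conditions.\<close>
      unfolding continuous_restriction_def asym_part_converse[symmetric]
      using closedin_sect[OF assms(1) _ S] openin_sect_asym_part[OF assms(1) _ _ S] mc Ar by blast
  qed
qed

end
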